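(* Let $q:G\to\mathbb Q/\mathbb Z$ and $q':G'\to\mathbb Q/\mathbb Z$ be two quadratic functions on torsion abelian groups, both satisfying the finiteness condition. Then $q$ and $q'$ are isomorphic if and only if there is a group isomorphism $\psi:G\to G'$ such that $\psi^*b_{q'}=b_q$, $\psi^*d_{q'}=d_q$, $\psi^*r_{q'}=r_q$, and there are $\psi$-compatible sections $s$ and $s'$ (of $G\to G/\mathrm{Ker}\,\widehat b_q$ and of $G'\to G'/\mathrm{Ker}\,\widehat b_{q'}$ respectively) such that $\gamma(q'\circ s')=\gamma(q\circ s)$.
   Context: A quadratic function on a torsion abelian group $G$ is a map $q:G\to\mathbb Q/\mathbb Z$ such that $b_q(x,y)=q(x+y)-q(x)-q(y)$ is $\mathbb Z$-bilinear. Let $\widehat b_q:G\to\mathrm{Hom}(G,\mathbb Q/\mathbb Z)$, $x\mapsto b_q(x,-)$. The homogeneity defect is $d_q(x)=q(x)-q(-x)$, a homomorphism $G\to\mathbb Q/\mathbb Z$. Let $r_q=q|_{\mathrm{Ker}\,\widehat b_q}:\mathrm{Ker}\,\widehat b_q\to\mathbb Q/\mathbb Z$, a homomorphism. Two quadratic functions $q,q'$ are isomorphic if there is a group isomorphism $\theta:G\to G'$ with $q'\circ\theta=q$. Pullbacks: $\psi^*b_{q'}(x,y)=b_{q'}(\psi(x),\psi(y))$, $\psi^*d_{q'}=d_{q'}\circ\psi$, and $\psi^*r_{q'}=r_{q'}\circ\psi|_{\mathrm{Ker}\,\widehat b_q}$ (note that $\psi^*b_{q'}=b_q$ forces $\psi(\mathrm{Ker}\,\widehat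 b_q)=\mathrm{Ker}\,\widehat b_{q'}$). $(G,q)$ meets the finiteness condition if $G/\mathrm{Ker}\,\widehat b_q$ is finite and the extension $0\to\mathrm{Ker}\,\widehat b_q\to G\to G/\mathrm{Ker}\,\widehat b_q\to0$ is split. Sections are group-homomorphism sections. If $\psi:G\to G'$ is an isomorphism with $\psi(\mathrm{Ker}\,\widehat b_q)=\mathrm{Ker}\,\widehat b_{q'}$, let $[\psi]:G/\mathrm{Ker}\,\widehat b_q\to G'/\mathrm{Ker}\,\widehat b_{q'}$ be the induced isomorphism; sections $s$ of $G\to G/\mathrm{Ker}\,\widehat b_q$ and $s'$ of $G'\to G'/\mathrm{Ker}\,\widehat b_{q'}$ are $\psi$-compatible if $s'=\psi\circ s\circ[\psi]^{-1}$. For a section $s$, $q\circ s$ is a nondegenerate quadratic function on the finite group $G/\mathrm{Ker}\,\widehat b_q$. For a quadratic function $Q$ on a finite abelian group $B$, $\gamma(Q)=|B|^{-1/2}\sum_{x\in B}\exp(2\pi i\,Q(x))$. *)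

theory Defs
  imports Complex_Main "HOL-Algebra.Coset"
begin

text \<open>
  Abelian groups are HOL-Algebra groups, hence written multiplicatively: the
  element \<open>x + y\<close> of the usual additive notation is \<open>x \<otimes>\<^bsub>G\<^esub> y\<close> and \<open>- x\<close> is \<open>inv\<^bsub>G\<^esub> x\<close>.
  This includes \<open>\<rat>/\<int>\<close>, whose elements are cosets \<open>r + \<int>\<close> of rational numbers.
\<close>

definition rat_group :: "rat monoid" where
  "rat_group = \<lparr>carrier = UNIV, mult = (+), one = 0\<rparr>"

definition QZ :: "rat set monoid" where
  "QZ = rat_group Mod \<int>"

text \<open>
  The map \<open>t \<mapsto> exp (2 \<pi> i t)\<close> on \<open>\<rat>/\<int>\<close>, computed on any representative of the coset \<open>t\<close>
  (see \<open>QZ_exp_coset\<close> below).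
\<close>

definition QZ_exp :: "rat set \<Rightarrow> complex" where
  "QZ_exp t = exp (2 * complex_of_real pi * \<i> * of_rat (SOME r. r \<in> t))"

definition torsion_group :: "('a, 'm) monoid_scheme \<Rightarrow> bool" where
  "torsion_group G \<longleftrightarrow> (\<forall>x\<in>carrier G. \<exists>n::nat. n > 0 \<and> x [^]\<^bsub>G\<^esub> n = \<one>\<^bsub>G\<^esub>)"

text \<open>\<open>b\<^sub>q(x, y) = q(x + y) - q(x) - q(y)\<close>\<close>

definition quad_b :: "('a, 'm) monoid_scheme \<Rightarrow> ('a \<Rightarrow> rat set) \<Rightarrow> 'a \<Rightarrow> 'a \<Rightarrow> rat set" where
  "quad_b G q x y = q (x \<otimes>\<^bsub>G\<^esub> y) \<otimes>\<^bsub>QZ\<^esub> inv\<^bsub>QZ\<^esub> (q x) \<otimes>\<^bsub>QZ\<^esub> inv\<^bsub>QZ\<^esub> (q y)"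

definition quadratic_function :: "('a, 'm) monoid_scheme \<Rightarrow> ('a \<Rightarrow> rat set) \<Rightarrow> bool" where
  "quadratic_function G q \<longleftrightarrow>
     q \<in> carrier G \<rightarrow> carrier QZ \<and>
     (\<forall>x\<in>carrier G. (\<lambda>y. quad_b G q x y) \<in> hom G QZ) \<and>
     (\<forall>y\<in>carrier G. (\<lambda>x. quad_b G q x y) \<in> hom G QZ)"

text \<open>
  The group \<open>Hom(G, \<rat>/\<int>)\<close>; homomorphisms are represented by functions that are
  \<open>undefined\<close> outside \<open>carrier G\<close>, so that equality is equality on \<open>carrier G\<close>.
\<close>

definition QZ_dual :: "('a, 'm) monoid_scheme \<Rightarrow> ('a \<Rightarrow> rat set) monoid" where
  "QZ_dual G =
     \<lparr>carrier = hom G QZ \<inter> extensional (carrier G),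
      mult = (\<lambda>f g. \<lambda>x\<in>carrier G. f x \<otimes>\<^bsub>QZ\<^esub> g x),
      one = (\<lambda>x\<in>carrier G. \<one>\<^bsub>QZ\<^esub>)\<rparr>"

definition quad_bhat :: "('a, 'm) monoid_scheme \<Rightarrow> ('a \<Rightarrow> rat set) \<Rightarrow> 'a \<Rightarrow> ('a \<Rightarrow> rat set)" where
  "quad_bhat G q x = (\<lambda>y\<in>carrier G. quad_b G q x y)"

definition quad_ker :: "('a, 'm) monoid_scheme \<Rightarrow> ('a \<Rightarrow> rat set) \<Rightarrow> 'a set" where
  "quad_ker G q = kernel G (QZ_dual G) (quad_bhat G q)"

text \<open>The homogeneity defect \<open>d\<^sub>q(x) = q(x) - q(-x)\<close>\<close>

definition quad_d :: "('a, 'm) monoid_scheme \<Rightarrow> ('a \<Rightarrow> rat set) \<Rightarrow> 'a \<Rightarrow> rat set" where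
  "quad_d G q x = q x \<otimes>\<^bsub>QZ\<^esub> inv\<^bsub>QZ\<^esub> (q (inv\<^bsub>G\<^esub> x))"

definition quad_r :: "('a, 'm) monoid_scheme \<Rightarrow> ('a \<Rightarrow> rat set) \<Rightarrow> 'a \<Rightarrow> rat set" where
  "quad_r G q = restrict q (quad_ker G q)"

definition quad_isomorphic ::
  "('a, 'm) monoid_scheme \<Rightarrow> ('a \<Rightarrow> rat set) \<Rightarrow> ('b, 'n) monoid_scheme \<Rightarrow> ('b \<Rightarrow> rat set) \<Rightarrow> bool" where
  "quad_isomorphic G q G' q' \<longleftrightarrow> (\<exists>\<theta>\<in>iso G G'. \<forall>x\<in>carrier G. q' (\<theta> x) = q x)"

definition group_section :: "('a, 'm) monoid_scheme \<Rightarrow> 'a set \<Rightarrow> ('a set \<Rightarrow> 'a) \<Rightarrow> bool" where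
  "group_section G K s \<longleftrightarrow>
     s \<in> hom (G Mod K) G \<and> (\<forall>C\<in>carrier (G Mod K). K #>\<^bsub>G\<^esub> s C = C)"

text \<open>A short exact sequence \<open>0 \<rightarrow> K \<rightarrow> G \<rightarrow> G/K \<rightarrow> 0\<close> is split iff \<open>G \<rightarrow> G/K\<close> has a section.\<close>

definition finiteness_condition :: "('a, 'm) monoid_scheme \<Rightarrow> ('a \<Rightarrow> rat set) \<Rightarrow> bool" where
  "finiteness_condition G q \<longleftrightarrow>
     finite (carrier (G Mod quad_ker G q)) \<and> (\<exists>s. group_section G (quad_ker G q) s)"

text \<open>
  If \<open>\<psi>\<close> is an isomorphism carrying \<open>K\<close> onto \<open>K'\<close>, the induced isomorphism \<open>[\<psi>] : G/K \<rightarrow> G'/K'\<close>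
  sends a coset, as a set, to its image under \<open>\<psi>\<close>. The condition below is
  \<open>s' = \<psi> \<circ> s \<circ> [\<psi>]\<^sup>-\<^sup>1\<close> on \<open>G'/K'\<close>.
\<close>

definition compatible_sections ::
  "('a, 'm) monoid_scheme \<Rightarrow> 'a set \<Rightarrow> ('b, 'n) monoid_scheme \<Rightarrow> 'b set \<Rightarrow>
   ('a \<Rightarrow> 'b) \<Rightarrow> ('a set \<Rightarrow> 'a) \<Rightarrow> ('b set \<Rightarrow> 'b) \<Rightarrow> bool" where
  "compatible_sections G K G' K' \<psi> s s' \<longleftrightarrow>
     (\<forall>C\<in>carrier (G' Mod K'). s' C = \<psi> (s (inv_into (carrier (G Mod K)) ((`) \<psi>) C)))"

definition gauss_sum :: "('a, 'm) monoid_scheme \<Rightarrow> ('a \<Rightarrow> rat set) \<Rightarrow> complex" where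
  "gauss_sum B Q =
     complex_of_real (real (card (carrier B)) powr (- 1 / 2)) * (\<Sum>x\<in>carrier B. QZ_exp (Q x))"

lemma rat_group_comm_group: "comm_group rat_group"
  by (rule comm_groupI) (auto simp: rat_group_def intro: exI[of _ "- x" for x])

lemma Ints_subgroup_rat_group: "subgroup \<int> rat_group"
proof -
  interpret comm_group rat_group by (rule rat_group_comm_group)
  have "inv\<^bsub>rat_group\<^esub> x = - x" for x
    by (rule inv_equality) (auto simp: rat_group_def)
  then show ?thesis
    by unfold_locales (auto simp: rat_group_def)
qed

lemma QZ_comm_group: "comm_group QZ"
  unfolding QZ_def
  by (rule comm_group.abelian_FactGroup[OF rat_group_comm_group Ints_subgroup_rat_group])

lemma carrier_QZ: "carrier QZ = range (\<lambda>r. \<int> #>\<^bsub>rat_group\<^esub> r)"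
  by (auto simp: QZ_def FactGroup_def RCOSETS_def rat_group_def)

lemma QZ_exp_coset:
  "QZ_exp (\<int> #>\<^bsub>rat_group\<^esub> r) = exp (2 * complex_of_real pi * \<i> * of_rat r)"
proof -
  have coset: "\<int> #>\<^bsub>rat_group\<^esub> r = {n + r |n. n \<in> \<int>}"
    by (auto simp: r_coset_def rat_group_def)
  have "r \<in> \<int> #>\<^bsub>rat_group\<^esub> r"
    unfolding coset by (auto intro: exI[of _ 0])
  then have "(SOME t. t \<in> \<int> #>\<^bsub>rat_group\<^esub> r) \<in> \<int> #>\<^bsub>rat_group\<^esub> r"
    by (rule someI)
  then obtain k :: int where k: "(SOME t. t \<in> \<int> #>\<^bsub>rat_group\<^esub> r) = of_int k + r"
    unfolding coset by (auto elim!: Ints_cases)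
  have "exp (2 * complex_of_real pi * \<i> * of_int k) = 1"
    using cis_multiple_2pi[of "of_int k"] by (simp add: cis_conv_exp mult_ac)
  then show ?thesis
    unfolding QZ_exp_def k by (simp add: of_rat_add distrib_left exp_add)
qed

lemma mem_quad_ker_iff:
  "x \<in> quad_ker G q \<longleftrightarrow> x \<in> carrier G \<and> (\<forall>y\<in>carrier G. quad_b G q x y = \<one>\<^bsub>QZ\<^esub>)"
  by (auto simp: quad_ker_def kernel_def quad_bhat_def QZ_dual_def restrict_def fun_eq_iff)

end

theory Submission
  imports Defs
begin

text \<open>
  An isomorphism \<open>\<theta>\<close> with \<open>q' \<circ> \<theta> = q\<close> visibly preserves \<open>b\<close>, \<open>d\<close>, \<open>r\<close>, and any section of
  \<open>G \<rightarrow> G/K\<close>, where \<open>K\<close> is the kernel of \<open>q\<close>, can be transported along \<open>\<theta>\<close>. The content is the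
  converse (\<open>quadratic_function_determined\<close>).

  Let \<open>\<psi>\<close> preserve all the invariants. Since \<open>q' \<circ> \<psi>\<close> and \<open>q\<close> have the same bilinear form, their
  difference \<open>\<chi>\<close> is a homomorphism \<open>G \<rightarrow> \<rat>/\<int>\<close>; since \<open>r\<close> is preserved, it vanishes on \<open>K\<close>. So it is
  determined by its values on the image of the section \<open>s\<close>, a finite group on which \<open>b\<^sub>q\<close> is
  nondegenerate, and hence perfect (\<open>character_represented\<close>): there is an \<open>a\<close> in the image of \<open>s\<close>
  with \<open>\<chi>(x) = b\<^sub>q(a, x)\<close> for all \<open>x\<close>. The other two invariants say how special \<open>a\<close> is.

  \<^item> The defects of \<open>q' \<circ> \<psi>\<close> and \<open>q\<close> differ by \<open>2 \<chi> = b\<^sub>q(2 a, -)\<close>. So \<open>2 a\<close> lies in \<open>K\<close> and in the image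
    of \<open>s\<close>, that is, \<open>2 a = 0\<close>.

  \<^item> On the finite part, \<open>q(x) + b\<^sub>q(a, x) = q(a + x) - q(a)\<close>. So the Gauss sum of \<open>q' \<circ> \<psi>\<close> is that of
    \<open>q\<close> divided by \<open>exp (2 \<pi> i q(a))\<close>; as Gauss sums of nondegenerate functions do not vanish, equality
    means \<open>q(a) = 0\<close> (\<open>represented_twist\<close>).

  Now \<open>b\<^sub>q(a, x)\<close> is \<open>0\<close> or \<open>1/2\<close>, and \<open>b\<^sub>q(a, a) = q(2 a) - 2 q(a) = 0\<close>. It follows that the map \<open>\<tau>\<close> with
  \<open>\<tau>(x) = x\<close> if \<open>b\<^sub>q(a, x) = 0\<close> and \<open>\<tau>(x) = a + x\<close> otherwise is an involutive automorphism of \<open>G\<close>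
  (\<open>transvection_iso\<close>), and \<open>q(\<tau>(x)) = q(x) + b\<^sub>q(a, x) = q'(\<psi>(x))\<close>. Hence \<open>\<psi> \<circ> \<tau>\<close> is an isomorphism
  from \<open>q\<close> to \<open>q'\<close>.

  All computations take place in the complex numbers, through the embedding
  \<open>t \<mapsto> exp (2 \<pi> i t)\<close> of \<open>\<rat>/\<int>\<close>: values of quadratic functions are multiplied, and the only square
  roots of \<open>1\<close> are \<open>1\<close> and \<open>-1\<close>.
\<close>

section \<open>The embedding of \<open>\<rat>/\<int>\<close> into the complex numbers\<close>

lemma QZ_mult_coset:
  "(\<int> #>\<^bsub>rat_group\<^esub> r) \<otimes>\<^bsub>QZ\<^esub> (\<int> #>\<^bsub>rat_group\<^esub> s) = \<int> #>\<^bsub>rat_group\<^esub> (r + s)"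
proof -
  interpret rat: comm_group rat_group by (rule rat_group_comm_group)
  interpret normal \<int> rat_group
    by (rule rat.subgroup_imp_normal[OF Ints_subgroup_rat_group])
  show ?thesis
    using rcos_sum[of r s] by (simp add: QZ_def) (simp add: rat_group_def)
qed

lemma QZ_exp_mult:
  assumes "a \<in> carrier QZ" "b \<in> carrier QZ"
  shows "QZ_exp (a \<otimes>\<^bsub>QZ\<^esub> b) = QZ_exp a * QZ_exp b"
proof -
  from assms obtain r s where "a = \<int> #>\<^bsub>rat_group\<^esub> r" "b = \<int> #>\<^bsub>rat_group\<^esub> s"
    by (auto simp: carrier_QZ)
  then show ?thesis
    by (simp add: QZ_mult_coset QZ_exp_coset of_rat_add distrib_left exp_add)
qed

lemma QZ_exp_nonzero [simp]: "QZ_exp t \<noteq> 0"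
  by (simp add: QZ_exp_def)

lemma QZ_exp_one [simp]: "QZ_exp \<one>\<^bsub>QZ\<^esub> = 1"
proof -
  interpret QZ: comm_group QZ by (rule QZ_comm_group)
  show ?thesis
    using QZ_exp_mult[of "\<one>\<^bsub>QZ\<^esub>" "\<one>\<^bsub>QZ\<^esub>"] by simp
qed

lemma QZ_exp_inv:
  assumes "a \<in> carrier QZ"
  shows "QZ_exp (inv\<^bsub>QZ\<^esub> a) = inverse (QZ_exp a)"
proof -
  interpret QZ: comm_group QZ by (rule QZ_comm_group)
  show ?thesis
    using QZ_exp_mult[of a "inv\<^bsub>QZ\<^esub> a"] assms by (simp add: inverse_unique)
qed

lemma of_real_of_rat: "of_real (of_rat r) = (of_rat r :: complex)"
  by (cases r) (simp add: of_rat_rat)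

lemma QZ_exp_inj: "inj_on QZ_exp (carrier QZ)"
proof (rule inj_onI)
  fix a b assume "a \<in> carrier QZ" "b \<in> carrier QZ" and eq: "QZ_exp a = QZ_exp b"
  then obtain r s where a: "a = \<int> #>\<^bsub>rat_group\<^esub> r" and b: "b = \<int> #>\<^bsub>rat_group\<^esub> s"
    by (auto simp: carrier_QZ)
  \<comment> \<open>The quotient of the two exponentials is \<open>1\<close>, so already its real part, the cosine, forces
    \<open>r - s\<close> to be an integer.\<close>
  have "exp (2 * complex_of_real pi * \<i> * of_rat (r - s)) = 1"
    using eq unfolding a b QZ_exp_coset by (simp add: of_rat_diff right_diff_distrib exp_diff)
  then have "cis (2 * pi * of_rat (r - s)) = 1"
    by (simp add: cis_conv_exp of_real_of_rat mult_ac)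
  then have "cos (2 * pi * of_rat (r - s)) = 1"
    by (metis cis.sel(1) one_complex.sel(1))
  then obtain n :: int where "2 * pi * of_rat (r - s) = of_int n * 2 * pi"
    unfolding cos_one_2pi_int by blast
  then have "of_rat (r - s) = (of_rat (of_int n) :: real)"
    by simp
  then have "r - s = of_int n"
    by (simp only: of_rat_eq_iff)
  then have r: "r = s + of_int n"
    by (simp add: algebra_simps)
  have "r \<in> \<int> #>\<^bsub>rat_group\<^esub> s"
    unfolding r r_coset_def by (auto simp: rat_group_def)
  moreover have "group rat_group"
    using rat_group_comm_group by (simp add: comm_group_def)
  moreover have "s \<in> carrier rat_group"
    by (simp add: rat_group_def)
  ultimately show "a = b"
    unfolding a b using group.repr_independence[OF _ _ _ Ints_subgroup_rat_group] by metis
qed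

section \<open>Characters, perfect pairings and Gauss sums on a finite group\<close>

text \<open>
  Values are required to be nonzero only: on a finite group they are then roots of unity.
\<close>

definition character :: "('a, 'm) monoid_scheme \<Rightarrow> ('a \<Rightarrow> complex) \<Rightarrow> bool" where
  "character G \<chi> \<longleftrightarrow> (\<forall>x\<in>carrier G. \<chi> x \<noteq> 0) \<and>
     (\<forall>x\<in>carrier G. \<forall>y\<in>carrier G. \<chi> (x \<otimes>\<^bsub>G\<^esub> y) = \<chi> x * \<chi> y)"

lemma (in group) character_one: "character G \<chi> \<Longrightarrow> \<chi> \<one> = 1"
  unfolding character_def by (metis one_closed l_one mult_cancel_right1)

lemma (in group) sum_left_translate:
  assumes "a \<in> carrier G"
  shows "(\<Sum>x\<in>carrier G. f (a \<otimes> x)) = (\<Sum>x\<in>carrier G. f x)"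
  by (rule sum.reindex_bij_witness[where i = "\<lambda>x. inv a \<otimes> x" and j = "\<lambda>x. a \<otimes> x"])
     (use assms in \<open>auto simp flip: m_assoc\<close>)

text \<open>Translating by \<open>a\<close> multiplies the sum by \<open>\<chi> a \<noteq> 1\<close>, and also leaves it unchanged.\<close>

lemma (in group) sum_character_eq_0:
  assumes "character G \<chi>" "a \<in> carrier G" "\<chi> a \<noteq> 1"
  shows "(\<Sum>x\<in>carrier G. \<chi> x) = 0"
proof -
  have "(\<Sum>x\<in>carrier G. \<chi> x) = (\<Sum>x\<in>carrier G. \<chi> (a \<otimes> x))"
    by (rule sum_left_translate[OF assms(2), symmetric])
  also have "\<dots> = \<chi> a * (\<Sum>x\<in>carrier G. \<chi> x)"
    using assms(1,2) by (simp add: character_def sum_distrib_left)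
  finally show ?thesis
    using assms(3) by simp
qed

locale nondegenerate_pairing = group B for B (structure) +
  fixes \<beta> :: "'a \<Rightarrow> 'a \<Rightarrow> complex"
  assumes finite_carrier: "finite (carrier B)"
    and character_left: "y \<in> carrier B \<Longrightarrow> character B (\<lambda>x. \<beta> x y)"
    and character_right: "x \<in> carrier B \<Longrightarrow> character B (\<beta> x)"
    and nondegenerate:
      "y \<in> carrier B \<Longrightarrow> (\<And>x. x \<in> carrier B \<Longrightarrow> \<beta> x y = 1) \<Longrightarrow> y = \<one>"
begin

lemma pairing_orthogonality:
  assumes "y \<in> carrier B"
  shows "(\<Sum>x\<in>carrier B. \<beta> x y) = (if y = \<one> then of_nat (card (carrier B)) else 0)"
proof (cases "y = \<one>")
  case True
  have "\<beta> x \<one> = 1" if "x \<in> carrier B" for x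
    using character_one[OF character_right[OF that]] .
  then show ?thesis
    using True by simp
next
  case False
  then obtain x where "x \<in> carrier B" "\<beta> x y \<noteq> 1"
    using nondegenerate[OF assms] by blast
  then show ?thesis
    using sum_character_eq_0[OF character_left[OF assms]] False by simp
qed

lemma card_nonzero: "of_nat (card (carrier B)) \<noteq> (0 :: complex)"
  using finite_carrier one_closed by auto

text \<open>
  A nondegenerate pairing on a finite group is perfect. If \<open>\<chi>\<close> differed from every \<open>\<beta> a\<close>, then each
  \<open>\<chi>\<^sup>-\<^sup>1 \<beta> a\<close> would be a nontrivial character with sum \<open>0\<close>. But summed over all \<open>a\<close> as well, these
  sums give \<open>|B|\<close>, because by orthogonality only the term at the neutral element survives.
\<close>

lemma character_represented:
  assumes \<chi>: "character B \<chi>"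
  shows "\<exists>a\<in>carrier B. \<forall>x\<in>carrier B. \<chi> x = \<beta> a x"
proof (rule ccontr)
  assume none: "\<not> ?thesis"
  have zero: "(\<Sum>x\<in>carrier B. inverse (\<chi> x) * \<beta> a x) = 0" if a: "a \<in> carrier B" for a
  proof -
    obtain x where x: "x \<in> carrier B" "\<chi> x \<noteq> \<beta> a x"
      using none a by blast
    have "character B (\<lambda>x. inverse (\<chi> x) * \<beta> a x)"
      using \<chi> character_right[OF a] by (simp add: character_def)
    moreover have "inverse (\<chi> x) * \<beta> a x \<noteq> 1"
      using x \<chi> by (auto simp: character_def field_simps)
    ultimately show ?thesis
      using sum_character_eq_0 x(1) by blast
  qed
  have "of_nat (card (carrier B))
      = (\<Sum>x\<in>carrier B. inverse (\<chi> x) * (if x = \<one> then of_nat (card (carrier B)) else 0))"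
    using finite_carrier character_one[OF \<chi>] by (simp add: if_distrib sum.delta cong: if_cong)
  also have "\<dots> = (\<Sum>x\<in>carrier B. \<Sum>a\<in>carrier B. inverse (\<chi> x) * \<beta> a x)"
    by (intro sum.cong refl) (simp add: pairing_orthogonality flip: sum_distrib_left)
  also have "\<dots> = (\<Sum>a\<in>carrier B. \<Sum>x\<in>carrier B. inverse (\<chi> x) * \<beta> a x)"
    by (rule sum.swap)
  also have "\<dots> = 0"
    using zero by simp
  finally show False
    using card_nonzero by blast
qed

end

text \<open>
  The function \<open>Q\<close> is the exponential of a quadratic function with associated bilinear form \<open>\<beta>\<close>.
\<close>

locale nondegenerate_quadratic = nondegenerate_pairing +
  fixes Q :: "'a \<Rightarrow> complex"
  assumes Q_nonzero: "x \<in> carrier B \<Longrightarrow> Q x \<noteq> 0"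
    and Q_mult:
      "x \<in> carrier B \<Longrightarrow> y \<in> carrier B \<Longrightarrow> Q (x \<otimes> y) = Q x * Q y * \<beta> x y"
begin

text \<open>
  Multiplied by \<open>\<Sum>\<^sub>y Q(y)\<^sup>-\<^sup>1\<close>, which is its complex conjugate when \<open>Q\<close> has absolute value \<open>1\<close>, the
  Gauss sum becomes \<open>|B| Q(1)\<close>: substitute \<open>x = y z\<close> and use \<open>Q(y z) Q(y)\<^sup>-\<^sup>1 = Q(z) \<beta>(y, z)\<close>.
\<close>

lemma sum_quadratic_nonzero: "(\<Sum>x\<in>carrier B. Q x) \<noteq> 0"
proof -
  have "(\<Sum>x\<in>carrier B. Q x) * (\<Sum>y\<in>carrier B. inverse (Q y))
      = (\<Sum>y\<in>carrier B. \<Sum>x\<in>carrier B. Q x * inverse (Q y))"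
    by (subst sum.swap) (rule sum_product)
  also have "\<dots> = (\<Sum>y\<in>carrier B. \<Sum>z\<in>carrier B. Q (y \<otimes> z) * inverse (Q y))"
    by (intro sum.cong refl sum_left_translate[symmetric])
  also have "\<dots> = (\<Sum>y\<in>carrier B. \<Sum>z\<in>carrier B. Q z * \<beta> y z)"
    by (intro sum.cong refl) (simp add: Q_mult Q_nonzero)
  also have "\<dots> = (\<Sum>z\<in>carrier B. \<Sum>y\<in>carrier B. Q z * \<beta> y z)"
    by (rule sum.swap)
  also have "\<dots> = (\<Sum>z\<in>carrier B. Q z * (if z = \<one> then of_nat (card (carrier B)) else 0))"
    by (intro sum.cong refl) (simp add: pairing_orthogonality flip: sum_distrib_left)
  also have "\<dots> = Q \<one> * of_nat (card (carrier B))"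
    using finite_carrier by (simp add: if_distrib sum.delta cong: if_cong)
  finally show ?thesis
    using Q_nonzero[OF one_closed] card_nonzero by auto
qed

text \<open>
  If \<open>\<chi> = \<beta> a\<close>, then \<open>Q(a) Q(x) \<chi>(x) = Q(a x)\<close>. So twisting by \<open>\<chi>\<close> divides the Gauss sum by \<open>Q(a)\<close>, and
  the twisted sum can equal the original nonzero one only if \<open>Q(a) = 1\<close>.
\<close>

lemma represented_twist:
  assumes "character B \<chi>"
    and sum_eq: "(\<Sum>x\<in>carrier B. Q x * \<chi> x) = (\<Sum>x\<in>carrier B. Q x)"
  obtains a where "a \<in> carrier B" "\<And>x. x \<in> carrier B \<Longrightarrow> \<chi> x = \<beta> a x" "Q a = 1"
proof -
  obtain a where a: "a \<in> carrier B" "\<And>x. x \<in> carrier B \<Longrightarrow> \<chi> x = \<beta> a x"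
    using character_represented[OF assms(1)] by blast
  have "Q a * (\<Sum>x\<in>carrier B. Q x) = (\<Sum>x\<in>carrier B. Q (a \<otimes> x))"
    unfolding sum_eq[symmetric] sum_distrib_left
    by (intro sum.cong refl) (simp add: Q_mult a)
  also have "\<dots> = (\<Sum>x\<in>carrier B. Q x)"
    by (rule sum_left_translate[OF a(1)])
  finally have "Q a = 1"
    using sum_quadratic_nonzero by simp
  then show thesis
    using that a by blast
qed

end

section \<open>Quadratic functions on abelian groups\<close>

locale quadratic_group = comm_group G for G (structure) +
  fixes q :: "'a \<Rightarrow> rat set"
  assumes quadratic: "quadratic_function G q"
begin

definition E :: "'a \<Rightarrow> complex" where "E x = QZ_exp (q x)"

definition \<beta> :: "'a \<Rightarrow> 'a \<Rightarrow> complex" where "\<beta> x y = QZ_exp (quad_b G q x y)"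

abbreviation K :: "'a set" where "K \<equiv> quad_ker G q"

lemma q_closed [simp]: "x \<in> carrier G \<Longrightarrow> q x \<in> carrier QZ"
  using quadratic by (auto simp: quadratic_function_def)

lemma E_nonzero [simp]: "E x \<noteq> 0"
  by (simp add: E_def)

lemma quad_b_closed:
  assumes "x \<in> carrier G" "y \<in> carrier G"
  shows "quad_b G q x y \<in> carrier QZ"
  using quadratic assms unfolding quadratic_function_def hom_def by blast

lemma \<beta>_eq_1_iff:
  assumes "x \<in> carrier G" "y \<in> carrier G"
  shows "\<beta> x y = 1 \<longleftrightarrow> quad_b G q x y = \<one>\<^bsub>QZ\<^esub>"
proof -
  interpret QZ: comm_group QZ by (rule QZ_comm_group)
  show ?thesis
    using inj_on_eq_iff[OF QZ_exp_inj quad_b_closed[OF assms] QZ.one_closed]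
    by (simp add: \<beta>_def)
qed

lemma E_mult:
  assumes "x \<in> carrier G" "y \<in> carrier G"
  shows "E (x \<otimes> y) = E x * E y * \<beta> x y"
proof -
  interpret QZ: comm_group QZ by (rule QZ_comm_group)
  show ?thesis
    using assms by (simp add: E_def \<beta>_def quad_b_def QZ_exp_mult QZ_exp_inv field_simps)
qed

lemma \<beta>_nonzero [simp]: "\<beta> x y \<noteq> 0"
  by (simp add: \<beta>_def)

lemma \<beta>_sym: "x \<in> carrier G \<Longrightarrow> y \<in> carrier G \<Longrightarrow> \<beta> x y = \<beta> y x"
  using E_mult[of x y] E_mult[of y x] by (simp add: m_comm mult_ac)

lemma \<beta>_right:
  assumes "x \<in> carrier G" "y \<in> carrier G" "z \<in> carrier G"
  shows "\<beta> x (y \<otimes> z) = \<beta> x y * \<beta> x z"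
proof -
  have "(\<lambda>y. quad_b G q x y) \<in> hom G QZ"
    using quadratic assms by (simp add: quadratic_function_def)
  then show ?thesis
    using assms by (simp add: \<beta>_def hom_mult QZ_exp_mult quad_b_closed)
qed

lemma \<beta>_left:
  assumes "x \<in> carrier G" "y \<in> carrier G" "z \<in> carrier G"
  shows "\<beta> (x \<otimes> y) z = \<beta> x z * \<beta> y z"
  using assms \<beta>_right[of z x y] by (simp add: \<beta>_sym)

lemma \<beta>_one [simp]: "x \<in> carrier G \<Longrightarrow> \<beta> x \<one> = 1"
  using \<beta>_right[of x \<one> \<one>] by simp

lemma E_one [simp]: "E \<one> = 1"
  using E_mult[of \<one> \<one>] by simp

lemma \<beta>_inv_right: "x \<in> carrier G \<Longrightarrow> y \<in> carrier G \<Longrightarrow> \<beta> x (inv y) = inverse (\<beta> x y)"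
  using \<beta>_right[of x y "inv y"] by (simp add: inverse_unique)

lemma \<beta>_inv_left: "x \<in> carrier G \<Longrightarrow> y \<in> carrier G \<Longrightarrow> \<beta> (inv x) y = inverse (\<beta> x y)"
  using \<beta>_inv_right[of y x] \<beta>_sym[of y x] \<beta>_sym[of y "inv x"] by simp

lemma mem_K_iff: "x \<in> K \<longleftrightarrow> x \<in> carrier G \<and> (\<forall>y\<in>carrier G. \<beta> x y = 1)"
  by (auto simp: mem_quad_ker_iff \<beta>_eq_1_iff)

lemma subgroup_K: "subgroup K G"
proof
  show "K \<subseteq> carrier G"
    by (auto simp: mem_K_iff)
  show "\<one> \<in> K"
    by (auto simp: mem_K_iff \<beta>_sym[of \<one>])
  show "x \<otimes> y \<in> K" if "x \<in> K" "y \<in> K" for x y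
    using that by (auto simp: mem_K_iff \<beta>_left)
  show "inv x \<in> K" if "x \<in> K" for x
    using that by (simp add: mem_K_iff \<beta>_inv_left)
qed

lemma section_closed:
  assumes "group_section G K s" "C \<in> carrier (G Mod K)"
  shows "s C \<in> carrier G"
  using assms by (auto simp: group_section_def hom_def)

lemma section_decompose:
  assumes s: "group_section G K s" and x: "x \<in> carrier G"
  obtains C k where "C \<in> carrier (G Mod K)" "k \<in> K" "x = k \<otimes> s C"
proof -
  have C: "K #> x \<in> carrier (G Mod K)"
    using x by (auto simp: carrier_FactGroup)
  have "x \<in> K #> x"
    using x subgroup_K by (rule rcos_self)
  then have "x \<in> K #> s (K #> x)"
    using s C by (simp add: group_section_def)
  then show thesis
    using that C by (auto simp: r_coset_def)
qed

text \<open>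
  Every element of \<open>G\<close> is the product of an element of \<open>K\<close> and a value of \<open>s\<close>. As \<open>K\<close> pairs trivially
  with everything, an element of the image of \<open>s\<close> that is orthogonal to this image is orthogonal to
  all of \<open>G\<close>.
\<close>

lemma section_nondegenerate:
  assumes s: "group_section G K s" and C: "C \<in> carrier (G Mod K)"
    and triv: "\<And>D. D \<in> carrier (G Mod K) \<Longrightarrow> \<beta> (s D) (s C) = 1"
  shows "C = \<one>\<^bsub>G Mod K\<^esub>"
proof -
  note sC = section_closed[OF s C]
  have "\<beta> (s C) y = 1" if y: "y \<in> carrier G" for y
  proof -
    obtain D k where D: "D \<in> carrier (G Mod K)" "k \<in> K" "y = k \<otimes> s D"
      using section_decompose[OF s y] .
    have k: "k \<in> carrier G" "\<beta> k (s C) = 1"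
      using D(2) sC by (auto simp: mem_K_iff)
    show ?thesis
      using D k sC section_closed[OF s D(1)] triv[OF D(1)]
      by (simp add: \<beta>_sym[of "s C"] \<beta>_left)
  qed
  then have "s C \<in> K"
    using sC by (simp add: mem_K_iff)
  then have "K #> s C = K"
    using coset_join2[OF sC subgroup_K] by simp
  then show ?thesis
    using s C by (simp add: group_section_def)
qed

lemma nondegenerate_quadratic_section:
  assumes s: "group_section G K s" and fin: "finite (carrier (G Mod K))"
  shows "nondegenerate_quadratic (G Mod K) (\<lambda>C D. \<beta> (s C) (s D)) (\<lambda>C. E (s C))"
proof -
  interpret Mod: comm_group "G Mod K"
    by (rule abelian_FactGroup[OF subgroup_K])
  have smult: "s (C \<otimes>\<^bsub>G Mod K\<^esub> D) = s C \<otimes> s D"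
    if "C \<in> carrier (G Mod K)" "D \<in> carrier (G Mod K)" for C D
    using s hom_mult[OF _ that] unfolding group_section_def by blast
  note cl = section_closed[OF s]
  show ?thesis
  proof (unfold_locales, goal_cases)
    case 1 show ?case by (rule fin)
  next
    case (2 y) then show ?case
      unfolding character_def by (auto simp only: smult cl \<beta>_left \<beta>_nonzero)
  next
    case (3 x) then show ?case
      unfolding character_def by (auto simp only: smult cl \<beta>_right \<beta>_nonzero)
  next
    case (4 y) then show ?case by (intro section_nondegenerate[OF s])
  next
    case (5 x) show ?case by simp
  next
    case (6 x y) then show ?case by (simp only: smult cl E_mult)
  qed
qed

text \<open>
  In additive notation this is \<open>x \<mapsto> x + 2 b\<^sub>q(a, x) a\<close>, the coefficient \<open>2 b\<^sub>q(a, x)\<close> being read in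
  \<open>\<int>/2\<close>. It is meaningful when \<open>2 a = 0\<close>, for then \<open>b\<^sub>q(a, x)\<close> is \<open>0\<close> or \<open>1/2\<close>.
\<close>

definition transvection :: "'a \<Rightarrow> 'a \<Rightarrow> 'a" where
  "transvection a x = (if \<beta> a x = 1 then x else a \<otimes> x)"

context
  fixes a
  assumes a: "a \<in> carrier G" and involution: "a \<otimes> a = \<one>" and E_a: "E a = 1"
begin

lemma \<beta>_involution_self: "\<beta> a a = 1"
  using E_mult[OF a a] by (simp add: involution E_a)

lemma \<beta>_involution_cases:
  assumes "x \<in> carrier G"
  shows "\<beta> a x = 1 \<or> \<beta> a x = - 1"
proof -
  have "\<beta> a x * \<beta> a x = 1"
    using \<beta>_left[OF a a assms] \<beta>_one[OF assms] by (simp add: involution \<beta>_sym[OF one_closed assms])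
  then show ?thesis
    by (simp add: square_eq_1_iff)
qed

lemma transvection_closed: "x \<in> carrier G \<Longrightarrow> transvection a x \<in> carrier G"
  using a by (simp add: transvection_def)

lemma transvection_involutive:
  assumes "x \<in> carrier G"
  shows "transvection a (transvection a x) = x"
  using a assms by (simp add: transvection_def \<beta>_right \<beta>_involution_self involution
      flip: m_assoc)

text \<open>
  When \<open>\<beta> a x = \<beta> a y = -1\<close>, the factor \<open>a\<close> appears twice on the right and cancels, in agreement with
  \<open>\<beta> a (x y) = 1\<close> on the left.
\<close>

lemma transvection_mult:
  assumes x: "x \<in> carrier G" and y: "y \<in> carrier G"
  shows "transvection a (x \<otimes> y) = transvection a x \<otimes> transvection a y"
proof -
  have *: "a \<otimes> x \<otimes> (a \<otimes> y) = x \<otimes> y"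
    using a x y involution by (metis m_assoc m_closed m_comm l_one)
  have **: "x \<otimes> (a \<otimes> y) = a \<otimes> (x \<otimes> y)"
    by (rule m_lcomm[OF x a y])
  show ?thesis
    using \<beta>_involution_cases[OF x] \<beta>_involution_cases[OF y] a x y
    by (auto simp: transvection_def \<beta>_right * ** m_assoc)
qed

lemma transvection_iso: "transvection a \<in> iso G G"
proof (rule isoI)
  show "transvection a \<in> hom G G"
    by (auto intro!: homI transvection_closed transvection_mult)
  show "bij_betw (transvection a) (carrier G) (carrier G)"
    by (rule bij_betw_byWitness[where f' = "transvection a"])
       (auto simp: transvection_involutive transvection_closed)
qed

lemma E_transvection:
  assumes x: "x \<in> carrier G"
  shows "E (transvection a x) = E x * \<beta> a x"
  using E_mult[OF a x] by (simp add: transvection_def E_a)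

end

end

section \<open>Transport along an isomorphism\<close>

lemma hom_image_coset:
  assumes "\<psi> \<in> hom G G'" "N \<subseteq> carrier G" "x \<in> carrier G"
  shows "\<psi> ` (N #>\<^bsub>G\<^esub> x) = (\<psi> ` N) #>\<^bsub>G'\<^esub> \<psi> x"
proof -
  have "\<psi> (k \<otimes>\<^bsub>G\<^esub> x) = \<psi> k \<otimes>\<^bsub>G'\<^esub> \<psi> x" if "k \<in> N" for k
    using assms that by (intro hom_mult[of \<psi> G G']) auto
  then show ?thesis
    by (simp add: r_coset_def image_UN)
qed

lemma iso_image_Mod:
  assumes "group G" and \<psi>: "\<psi> \<in> iso G G'"
    and N: "subgroup N G" and N': "\<psi> ` N = N'"
  shows "(`) \<psi> \<in> iso (G Mod N) (G' Mod N')"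
proof (rule isoI)
  have hom: "\<psi> \<in> hom G G'" and bij: "bij_betw \<psi> (carrier G) (carrier G')"
    using \<psi> by (auto simp: iso_def)
  have Nsub: "N \<subseteq> carrier G"
    using N by (rule subgroup.subset)
  have sub: "C \<subseteq> carrier G" if "C \<in> carrier (G Mod N)" for C
    using that monoid.r_coset_subset_G[OF group.is_monoid[OF assms(1)] Nsub]
    by (auto simp: carrier_FactGroup)
  have img: "(`) \<psi> ` carrier (G Mod N) = carrier (G' Mod N')"
    unfolding carrier_FactGroup bij_betw_imp_surj_on[OF bij, symmetric] image_image
    using hom_image_coset[OF hom Nsub] N' by simp
  have "\<psi> ` (C <#>\<^bsub>G\<^esub> D) = (\<psi> ` C) <#>\<^bsub>G'\<^esub> (\<psi> ` D)" if "C \<subseteq> carrier G" "D \<subseteq> carrier G" for C D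
    using set_mult_hom[OF hom that] .
  then show "(`) \<psi> \<in> hom (G Mod N) (G' Mod N')"
    using img sub by (auto simp: hom_def)
  have "inj_on ((`) \<psi>) (carrier (G Mod N))"
    using sub inj_on_image_eq_iff[OF bij_betw_imp_inj_on[OF bij]] by (auto intro!: inj_onI)
  then show "bij_betw ((`) \<psi>) (carrier (G Mod N)) (carrier (G' Mod N'))"
    using img by (simp add: bij_betw_def)
qed

lemma quad_ker_image:
  assumes "quadratic_group G q" "quadratic_group G' q'" and \<psi>: "\<psi> \<in> iso G G'"
    and b: "\<And>x y. x \<in> carrier G \<Longrightarrow> y \<in> carrier G \<Longrightarrow>
      quad_b G' q' (\<psi> x) (\<psi> y) = quad_b G q x y"
  shows "\<psi> ` quad_ker G q = quad_ker G' q'"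
proof -
  have img: "carrier G' = \<psi> ` carrier G"
    using \<psi> by (auto simp: iso_def bij_betw_def)
  have "\<psi> x \<in> quad_ker G' q' \<longleftrightarrow> x \<in> quad_ker G q" if "x \<in> carrier G" for x
    using that b by (simp add: mem_quad_ker_iff img)
  moreover have "quad_ker G q \<subseteq> carrier G" "quad_ker G' q' \<subseteq> \<psi> ` carrier G"
    by (auto simp: mem_quad_ker_iff img)
  ultimately show ?thesis
    by blast
qed

text \<open>
  Compatibility says that \<open>s'\<close> takes the value \<open>\<psi> (s C)\<close> at the image of a coset \<open>C\<close>, so the second
  Gauss sum can be taken over the cosets in \<open>G\<close>.
\<close>

lemma gauss_sum_compatible_sections:
  assumes "group G" "\<psi> \<in> iso G G'" "subgroup N G" "\<psi> ` N = N'"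
    and compat: "compatible_sections G N G' N' \<psi> s s'"
  shows "gauss_sum (G' Mod N') (q' \<circ> s') = gauss_sum (G Mod N) (q' \<circ> \<psi> \<circ> s)"
proof -
  have "(`) \<psi> \<in> iso (G Mod N) (G' Mod N')"
    using assms(1-4) by (rule iso_image_Mod)
  then have bij: "bij_betw ((`) \<psi>) (carrier (G Mod N)) (carrier (G' Mod N'))"
    by (simp add: iso_def)
  have "s' (\<psi> ` C) = \<psi> (s C)" if C: "C \<in> carrier (G Mod N)" for C
    using compat bij_betwE[OF bij] C inv_into_f_f[OF bij_betw_imp_inj_on[OF bij] C]
    by (simp add: compatible_sections_def)
  then have "(\<Sum>C\<in>carrier (G' Mod N'). QZ_exp (q' (s' C)))
      = (\<Sum>C\<in>carrier (G Mod N). QZ_exp (q' (\<psi> (s C))))"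
    using sum.reindex_bij_betw[OF bij, of "\<lambda>C. QZ_exp (q' (s' C))"] by simp
  then show ?thesis
    using bij_betw_same_card[OF bij] by (simp add: gauss_sum_def)
qed

lemma transported_section:
  assumes G: "comm_group G" and \<psi>: "\<psi> \<in> iso G G'" and N: "subgroup N G" "\<psi> ` N = N'"
    and s: "group_section G N s"
  shows "group_section G' N' (\<psi> \<circ> s \<circ> inv_into (carrier (G Mod N)) ((`) \<psi>))"
proof -
  let ?j = "inv_into (carrier (G Mod N)) ((`) \<psi>)"
  have hom: "\<psi> \<in> hom G G'"
    using \<psi> by (simp add: iso_def)
  have i: "(`) \<psi> \<in> iso (G Mod N) (G' Mod N')"
    using G \<psi> N by (intro iso_image_Mod) (simp_all add: comm_group_def)
  have Mod: "group (G Mod N)"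
    using comm_group.abelian_FactGroup[OF G N(1)] by (simp add: comm_group_def)
  have j: "?j \<in> hom (G' Mod N') (G Mod N)"
    using group.iso_set_sym[OF Mod i] by (simp add: iso_def)
  have s_hom: "s \<in> hom (G Mod N) G"
    using s by (simp add: group_section_def)
  have "\<psi> \<circ> s \<circ> ?j \<in> hom (G' Mod N') G'"
    using hom_compose[OF j hom_compose[OF s_hom hom]] by (simp add: comp_assoc)
  moreover have "N' #>\<^bsub>G'\<^esub> \<psi> (s (?j C)) = C" if C: "C \<in> carrier (G' Mod N')" for C
  proof -
    have jC: "?j C \<in> carrier (G Mod N)" "\<psi> ` ?j C = C"
      using j i C f_inv_into_f[of C "(`) \<psi>"] by (auto simp: hom_def iso_def bij_betw_def)
    have "s (?j C) \<in> carrier G"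
      using s_hom jC(1) by (auto simp: hom_def)
    then have "N' #>\<^bsub>G'\<^esub> \<psi> (s (?j C)) = \<psi> ` (N #>\<^bsub>G\<^esub> s (?j C))"
      using hom_image_coset[OF hom subgroup.subset[OF N(1)]] N(2) by simp
    also have "\<dots> = C"
      using s jC by (simp add: group_section_def)
    finally show ?thesis .
  qed
  ultimately show ?thesis
    by (simp add: group_section_def)
qed

section \<open>The classification\<close>

text \<open>
  The Gauss sums compared here are both on \<open>G\<close>, those of \<open>q' \<circ> \<psi>\<close> and of \<open>q\<close>, so that the two
  functions differ by the character \<open>\<chi>\<close> below and one section suffices.
\<close>

lemma quadratic_function_determined:
  assumes "quadratic_group G q" "quadratic_group G' q'"
    and fin: "finite (carrier (G Mod quad_ker G q))"
    and \<psi>: "\<psi> \<in> iso G G'"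
    and b: "\<And>x y. x \<in> carrier G \<Longrightarrow> y \<in> carrier G \<Longrightarrow>
      quad_b G' q' (\<psi> x) (\<psi> y) = quad_b G q x y"
    and d: "\<And>x. x \<in> carrier G \<Longrightarrow> quad_d G' q' (\<psi> x) = quad_d G q x"
    and r: "\<And>x. x \<in> quad_ker G q \<Longrightarrow> q' (\<psi> x) = q x"
    and s: "group_section G (quad_ker G q) s"
    and gauss: "gauss_sum (G Mod quad_ker G q) (q' \<circ> \<psi> \<circ> s) = gauss_sum (G Mod quad_ker G q) (q \<circ> s)"
  shows "quad_isomorphic G q G' q'"
proof -
  interpret G: quadratic_group G q by fact
  interpret G': quadratic_group G' q' by fact
  interpret QZ: comm_group QZ by (rule QZ_comm_group)
  interpret finite_part: nondegenerate_quadratic "G Mod G.K" "\<lambda>C D. G.\<beta> (s C) (s D)" "\<lambda>C. G.E (s C)"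
    by (rule G.nondegenerate_quadratic_section[OF s fin])
  have hom: "\<psi> \<in> hom G G'"
    using \<psi> by (simp add: iso_def)
  note [simp] = hom_in_carrier[OF hom]
  have \<psi>_inv: "\<psi> (inv\<^bsub>G\<^esub> x) = inv\<^bsub>G'\<^esub> \<psi> x" if "x \<in> carrier G" for x
    using group_hom.hom_inv[of G G' \<psi> x] that hom G.group_axioms G'.group_axioms
    by (simp add: group_hom_def group_hom_axioms_def)
  have \<beta>_eq: "G'.\<beta> (\<psi> x) (\<psi> y) = G.\<beta> x y" if "x \<in> carrier G" "y \<in> carrier G" for x y
    using b[OF that] by (simp add: G'.\<beta>_def G.\<beta>_def)
  define \<chi> where "\<chi> x = G'.E (\<psi> x) / G.E x" for x
  have \<chi>_nonzero: "\<chi> x \<noteq> 0" for x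
    by (simp add: \<chi>_def)
  have \<chi>_mult: "\<chi> (x \<otimes>\<^bsub>G\<^esub> y) = \<chi> x * \<chi> y" if "x \<in> carrier G" "y \<in> carrier G" for x y
    using that by (simp add: \<chi>_def hom_mult[OF hom] G.E_mult G'.E_mult \<beta>_eq)
  have \<chi>_K: "\<chi> x = 1" if "x \<in> G.K" for x
    using r[OF that] by (simp add: \<chi>_def G'.E_def G.E_def QZ_exp_def)
  have "character (G Mod G.K) (\<lambda>C. \<chi> (s C))"
    unfolding character_def
    using s G.section_closed[OF s] \<chi>_nonzero \<chi>_mult hom_mult[of s "G Mod G.K" G]
    by (auto simp: group_section_def simp del: mult_FactGroup)
  moreover have "(\<Sum>C\<in>carrier (G Mod G.K). G.E (s C) * \<chi> (s C)) = (\<Sum>C\<in>carrier (G Mod G.K). G.E (s C))"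
    using gauss finite_part.card_nonzero by (simp add: gauss_sum_def \<chi>_def G.E_def G'.E_def)
  ultimately obtain A where A: "A \<in> carrier (G Mod G.K)"
    and \<chi>_A: "\<And>C. C \<in> carrier (G Mod G.K) \<Longrightarrow> \<chi> (s C) = G.\<beta> (s A) (s C)"
    and E_A: "G.E (s A) = 1"
    using finite_part.represented_twist by blast
  define a where "a = s A"
  have a: "a \<in> carrier G"
    using G.section_closed[OF s A] by (simp add: a_def)
  \<comment> \<open>Both sides are characters of \<open>G\<close> which are trivial on \<open>K\<close> and agree on the image of \<open>s\<close>.\<close>
  have \<chi>_a: "\<chi> x = G.\<beta> a x" if x: "x \<in> carrier G" for x
  proof -
    obtain C k where C: "C \<in> carrier (G Mod G.K)" and k: "k \<in> G.K" and x_eq: "x = k \<otimes>\<^bsub>G\<^esub> s C"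
      using G.section_decompose[OF s x] .
    have "k \<in> carrier G" "G.\<beta> a k = 1"
      using k a by (auto simp: G.mem_K_iff G.\<beta>_sym[of a])
    then show ?thesis
      using G.section_closed[OF s C] a k
      by (simp add: x_eq \<chi>_mult G.\<beta>_right \<chi>_K \<chi>_A[OF C, folded a_def])
  qed
  \<comment> \<open>Equality of the defects means \<open>\<chi>(x) = \<chi>(x\<^sup>-\<^sup>1)\<close>, so \<open>\<chi>\<^sup>2\<close> is trivial.\<close>
  have "G.\<beta> (a \<otimes>\<^bsub>G\<^esub> a) x = 1" if x: "x \<in> carrier G" for x
  proof -
    have "G'.E (\<psi> x) / G'.E (\<psi> (inv\<^bsub>G\<^esub> x)) = G.E x / G.E (inv\<^bsub>G\<^esub> x)"
      using arg_cong[OF d[OF x], of QZ_exp] x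
      by (simp add: quad_d_def QZ_exp_mult QZ_exp_inv G.E_def G'.E_def \<psi>_inv divide_inverse)
    then have "\<chi> x = \<chi> (inv\<^bsub>G\<^esub> x)"
      by (simp add: \<chi>_def field_simps)
    then show ?thesis
      using x a by (simp add: \<chi>_a G.\<beta>_left G.\<beta>_inv_right field_simps)
  qed
  then have aa_K: "a \<otimes>\<^bsub>G\<^esub> a \<in> G.K"
    using a by (simp add: G.mem_K_iff)
  \<comment> \<open>The image of \<open>s\<close> meets \<open>K\<close> only in the neutral element, and \<open>a a = s (A A)\<close>.\<close>
  have involution: "a \<otimes>\<^bsub>G\<^esub> a = \<one>\<^bsub>G\<^esub>"
  proof -
    have s_hom: "s \<in> hom (G Mod G.K) G"
      using s by (simp add: group_section_def)
    have saa: "s (A \<otimes>\<^bsub>G Mod G.K\<^esub> A) = a \<otimes>\<^bsub>G\<^esub> a"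
      using hom_mult[OF s_hom A A] by (simp add: a_def)
    have "A \<otimes>\<^bsub>G Mod G.K\<^esub> A = G.K #>\<^bsub>G\<^esub> (a \<otimes>\<^bsub>G\<^esub> a)"
      using s finite_part.m_closed[OF A A] saa unfolding group_section_def by metis
    also have "\<dots> = \<one>\<^bsub>G Mod G.K\<^esub>"
      using G.coset_join2[OF _ G.subgroup_K aa_K] a by simp
    finally show ?thesis
      using saa hom_one[OF s_hom finite_part.group_axioms G.group_axioms] by simp
  qed
  let ?\<tau> = "G.transvection a"
  have \<tau>: "?\<tau> \<in> iso G G"
    using a involution E_A by (intro G.transvection_iso) (simp_all add: a_def)
  have "q' (\<psi> (?\<tau> x)) = q x" if x: "x \<in> carrier G" for x
  proof -
    have Ea: "G.E a = 1"
      using E_A by (simp add: a_def)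
    have \<tau>x: "?\<tau> x \<in> carrier G"
      by (rule G.transvection_closed[OF a involution Ea x])
    have "G'.E (\<psi> (?\<tau> x)) = G.E (?\<tau> x) * \<chi> (?\<tau> x)"
      by (simp add: \<chi>_def)
    \<comment> \<open>\<open>q' \<circ> \<psi> = q \<circ> \<tau>\<close>, applied at \<open>\<tau> x\<close>; as \<open>\<tau>\<close> is involutive, precomposing with \<open>\<tau>\<close> undoes it.\<close>
    also have "\<dots> = G.E (?\<tau> (?\<tau> x))"
      using G.E_transvection[OF a involution Ea \<tau>x] \<chi>_a[OF \<tau>x] by simp
    also have "\<dots> = G.E x"
      by (simp add: G.transvection_involutive[OF a involution Ea x])
    finally show ?thesis
      using \<tau>x x by (intro inj_onD[OF QZ_exp_inj]) (simp_all add: G.E_def G'.E_def)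
  qed
  moreover have "\<psi> \<circ> ?\<tau> \<in> iso G G'"
    using \<tau> \<psi> by (rule iso_set_trans)
  ultimately show ?thesis
    unfolding quad_isomorphic_def by (intro bexI[of _ "\<psi> \<circ> ?\<tau>"]) simp_all
qed

theorem corollary4p6:
  fixes G :: "('a, 'm) monoid_scheme" and G' :: "('b, 'n) monoid_scheme"
    and q :: "'a \<Rightarrow> rat set" and q' :: "'b \<Rightarrow> rat set"
  assumes "comm_group G" and "torsion_group G"
    and "comm_group G'" and "torsion_group G'"
    and "quadratic_function G q" and "quadratic_function G' q'"
    and "finiteness_condition G q" and "finiteness_condition G' q'"
  shows "quad_isomorphic G q G' q' \<longleftrightarrow>
    (\<exists>\<psi>\<in>iso G G'.
       (\<forall>x\<in>carrier G. \<forall>y\<in>carrier G. quad_b G' q' (\<psi> x) (\<psi> y) = quad_b G q x y) \<and>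
       (\<forall>x\<in>carrier G. quad_d G' q' (\<psi> x) = quad_d G q x) \<and>
       (\<forall>x\<in>quad_ker G q. quad_r G' q' (\<psi> x) = quad_r G q x) \<and>
       (\<exists>s s'. group_section G (quad_ker G q) s \<and>
               group_section G' (quad_ker G' q') s' \<and>
               compatible_sections G (quad_ker G q) G' (quad_ker G' q') \<psi> s s' \<and>
               gauss_sum (G' Mod quad_ker G' q') (q' \<circ> s') =
               gauss_sum (G Mod quad_ker G q) (q \<circ> s)))"
    (is "_ \<longleftrightarrow> ?invariants")
proof -
  have quad: "quadratic_group G q" "quadratic_group G' q'"
    using assms by (simp_all add: quadratic_group_def quadratic_group_axioms_def)
  interpret G: quadratic_group G q by fact
  interpret G': quadratic_group G' q' by fact
  have fin: "finite (carrier (G Mod G.K))"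
    using assms(7) by (simp add: finiteness_condition_def)
  show ?thesis
  proof
    assume "quad_isomorphic G q G' q'"
    then obtain \<theta> where \<theta>: "\<theta> \<in> iso G G'" and q\<theta>: "\<And>x. x \<in> carrier G \<Longrightarrow> q' (\<theta> x) = q x"
      by (auto simp: quad_isomorphic_def)
    have hom: "\<theta> \<in> hom G G'"
      using \<theta> by (simp add: iso_def)
    have \<theta>_inv: "\<theta> (inv\<^bsub>G\<^esub> x) = inv\<^bsub>G'\<^esub> \<theta> x" if "x \<in> carrier G" for x
      using group_hom.hom_inv[of G G' \<theta> x] that hom G.group_axioms G'.group_axioms
      by (simp add: group_hom_def group_hom_axioms_def)
    have b: "quad_b G' q' (\<theta> x) (\<theta> y) = quad_b G q x y" if "x \<in> carrier G" "y \<in> carrier G" for x y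
      using that by (simp add: quad_b_def q\<theta> flip: hom_mult[OF hom])
    have d: "quad_d G' q' (\<theta> x) = quad_d G q x" if "x \<in> carrier G" for x
      using that by (simp add: quad_d_def q\<theta> flip: \<theta>_inv)
    have ker: "\<theta> ` G.K = G'.K"
      using quad \<theta> b by (rule quad_ker_image)
    have r: "quad_r G' q' (\<theta> x) = quad_r G q x" if "x \<in> G.K" for x
      using that ker q\<theta> by (auto simp: quad_r_def G.mem_K_iff)
    obtain s where s: "group_section G G.K s"
      using assms(7) by (auto simp: finiteness_condition_def)
    let ?s' = "\<theta> \<circ> s \<circ> inv_into (carrier (G Mod G.K)) ((`) \<theta>)"
    have s': "group_section G' G'.K ?s'"
      by (rule transported_section[OF G.comm_group_axioms \<theta> G.subgroup_K ker s])
    have compat: "compatible_sections G G.K G' G'.K \<theta> s ?s'"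
      by (simp add: compatible_sections_def)
    have "gauss_sum (G' Mod G'.K) (q' \<circ> ?s') = gauss_sum (G Mod G.K) (q' \<circ> \<theta> \<circ> s)"
      by (rule gauss_sum_compatible_sections[OF G.group_axioms \<theta> G.subgroup_K ker compat])
    also have "\<dots> = gauss_sum (G Mod G.K) (q \<circ> s)"
      using G.section_closed[OF s] q\<theta> by (simp add: gauss_sum_def)
    finally have gauss: "gauss_sum (G' Mod G'.K) (q' \<circ> ?s') = gauss_sum (G Mod G.K) (q \<circ> s)" .
    show ?invariants
      using b d r s s' compat gauss
      by (intro bexI[of _ \<theta>] conjI ballI exI[of _ s] exI[of _ ?s'] \<theta>) assumption+
  next
    assume ?invariants
    then obtain \<psi> s s' where \<psi>: "\<psi> \<in> iso G G'"
      and b: "\<And>x y. x \<in> carrier G \<Longrightarrow> y \<in> carrier G \<Longrightarrow>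
        quad_b G' q' (\<psi> x) (\<psi> y) = quad_b G q x y"
      and d: "\<And>x. x \<in> carrier G \<Longrightarrow> quad_d G' q' (\<psi> x) = quad_d G q x"
      and r: "\<And>x. x \<in> G.K \<Longrightarrow> quad_r G' q' (\<psi> x) = quad_r G q x"
      and s: "group_section G G.K s"
      and compat: "compatible_sections G G.K G' G'.K \<psi> s s'"
      and gauss: "gauss_sum (G' Mod G'.K) (q' \<circ> s') = gauss_sum (G Mod G.K) (q \<circ> s)"
      by blast
    have ker: "\<psi> ` G.K = G'.K"
      using quad \<psi> b by (rule quad_ker_image)
    have "q' (\<psi> x) = q x" if "x \<in> G.K" for x
    proof -
      have "\<psi> x \<in> G'.K"
        using that ker by blast
      then show ?thesis
        using r[OF that] that by (simp add: quad_r_def)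
    qed
    moreover have "gauss_sum (G Mod G.K) (q' \<circ> \<psi> \<circ> s) = gauss_sum (G Mod G.K) (q \<circ> s)"
      using gauss_sum_compatible_sections[OF G.group_axioms \<psi> G.subgroup_K ker compat, of q'] gauss by simp
    ultimately show "quad_isomorphic G q G' q'"
      using quadratic_function_determined[OF quad fin \<psi> b d _ s] by blast
  qed
qed

end
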